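(* Let $f:\mathbb{C}\to\mathbb{C}$ be a transcendental entire function, let $D$ be an open disc meeting $J(f)$, and suppose that there exist Jordan curves $\gamma_n\subset\mathbb{C}$, $n\in\mathbb{N}$, such that, for all $n\in\mathbb{N}$, $\gamma_n$ surrounds $f^n(D)$ and $f(\gamma_n)$ surrounds the bounded component of $\mathbb{C}\setminus\gamma_{n+1}$. Then $F(f)$ has no unbounded components.
   Context: $\mathbb{N}=\{1,2,3,\dots\}$ and $f^n$ denotes the $n$th iterate of $f$. The Fatou set $F(f)$ is the set of $z\in\mathbb{C}$ such that $(f^n)_{n\in\mathbb{N}}$ is a normal family in some neighbourhood of $z$; the Julia set is $J(f)=\mathbb{C}\setminus F(f)$. A compact set $\gamma$ surrounds a connected set $S$ if $S$ lies in a bounded component of $\mathbb{C}\setminus\gamma$. *)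

theory Defs
  imports "HOL-Complex_Analysis.Complex_Analysis"
begin

definition transcendental_entire :: "(complex \<Rightarrow> complex) \<Rightarrow> bool" where
  "transcendental_entire f \<longleftrightarrow>
     f holomorphic_on UNIV \<and> \<not> (\<exists>p. \<forall>z. f z = poly p z)"

(* Local uniform convergence in the Riemann sphere: on a domain, a sequence of holomorphic
   functions converges locally uniformly in the spherical metric iff it converges locally
   uniformly to a finite (holomorphic) function or tends to infinity locally uniformly.
   On a disconnected U the two alternatives could be mixed; this does not affect
   the Fatou set, where U may be shrunk to a disc. *)
definition normal_family :: "(complex \<Rightarrow> complex) set \<Rightarrow> complex set \<Rightarrow> bool" where
  "normal_family \<F> U \<longleftrightarrow>
     (\<forall>\<phi>. range \<phi> \<subseteq> \<F> \<longrightarrow>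
        (\<exists>r :: nat \<Rightarrow> nat. strict_mono r \<and>
           ((\<exists>g. \<forall>K. compact K \<and> K \<subseteq> U \<longrightarrow> uniform_limit K (\<phi> \<circ> r) g sequentially) \<or>
            (\<forall>K. compact K \<and> K \<subseteq> U \<longrightarrow>
               (\<forall>B. \<forall>\<^sub>F n in sequentially. \<forall>z\<in>K. norm (\<phi> (r n) z) > B)))))"

definition Fatou_set :: "(complex \<Rightarrow> complex) \<Rightarrow> complex set" where
  "Fatou_set f = {z. \<exists>U. open U \<and> z \<in> U \<and> normal_family {f ^^ n |n. n \<ge> 1} U}"

definition Julia_set :: "(complex \<Rightarrow> complex) \<Rightarrow> complex set" where
  "Julia_set f = - Fatou_set f"

definition Jordan_curve :: "complex set \<Rightarrow> bool" where
  "Jordan_curve \<gamma> \<longleftrightarrow>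
     (\<exists>c. simple_path c \<and> pathfinish c = pathstart c \<and> path_image c = \<gamma>)"

(* Meant for compact \<gamma> and connected S. *)
definition surrounds :: "complex set \<Rightarrow> complex set \<Rightarrow> bool" where
  "surrounds \<gamma> S \<longleftrightarrow> (\<exists>C \<in> components (- \<gamma>). bounded C \<and> S \<subseteq> C)"

(* For a Jordan curve, the library's inside is the bounded complementary component. *)
lemma inside_Jordan_curve:
  assumes "Jordan_curve \<gamma>"
  shows "C \<in> components (- \<gamma>) \<and> bounded C \<longleftrightarrow> C = inside \<gamma>"
proof -
  obtain c where c: "simple_path c" "pathfinish c = pathstart c" "path_image c = \<gamma>"
    using assms by (auto simp: Jordan_curve_def)
  have ins: "inside \<gamma> \<noteq> {}" "connected (inside \<gamma>)" "bounded (inside \<gamma>)"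
    using Jordan_inside_outside[OF c(1,2)] c(3) by auto
  have "closed \<gamma>"
    using c closed_simple_path_image by blast
  then have in_comp: "inside \<gamma> \<in> components (- \<gamma>)"
    using ins by (simp add: inside_in_components)
  have "C = inside \<gamma>" if C: "C \<in> components (- \<gamma>)" "bounded C"
  proof -
    obtain x where x: "x \<in> - \<gamma>" "C = connected_component_set (- \<gamma>) x"
      using C(1) by (auto simp: components_iff)
    then have "x \<in> inside \<gamma>" "x \<in> C"
      using C(2) by (auto simp: inside_def)
    then show ?thesis
      using components_eq[OF C(1) in_comp] by blast
  qed
  then show ?thesis
    using in_comp ins(3) by blast
qed

end

(* Suppose that a Fatou component U is unbounded and fix a point w in U. By Montel's theorem some
   iterate f^m maps D over a circle of any prescribed large radius, so by the maximum principle
   f^k maps a disc B of prescribed size into the inside G(k+m) of gamma(k+m), for all k.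
   A path K in U from w to a point outside G(m) has f^k(K) not contained in G(k+m) for every k,
   since f^k(K) meets gamma(k+m), whose image misses G(k+m+1). As f^k omits on B the complement
   of G(k+m), which contains a point of f^k(K), Schottky's theorem bounds f^k on half of B by a
   multiple of its maximum on K. Hence f^k is unbounded on K (otherwise D would lie in the Fatou
   set), so along a subsequence f^k tends to infinity near K, and Harnack's inequality for
   log|f^k| bounds that maximum by a power |f^k(w)|^L, where L depends on K only.
   But f^k maps a disc of fixed size over a circle of radius comparable to |f^k(w)|, on which
   |f| exceeds every power of the radius, and f o f^k = f^k o f; so f^k is larger than that on
   half of B if B was chosen large enough. Schottky's theorem needs a centre whose orbit stays
   below these radii: a point of period at most two. *)
theory Submission
  imports Defs
begin

subsection \<open>Schottky and Montel for omitted values on two circles\<close>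

lemma Schottky_ball:
  fixes p :: complex
  assumes "0 < r'" "r' < r"
  obtains B where "\<And>h z. \<lbrakk>h holomorphic_on ball p r; \<And>z. z \<in> ball p r \<Longrightarrow> h z \<noteq> 0 \<and> h z \<noteq> 1;
      norm (h p) \<le> b; z \<in> cball p r'\<rbrakk> \<Longrightarrow> norm (h z) \<le> B"
proof -
  \<comment> \<open>The disc form of Schottky's theorem asks for a map that is holomorphic on the
    closed unit disc, while \<open>h\<close> lives on an open disc of radius \<open>r\<close>.
    Rescaling by an intermediate radius \<open>s\<close> closes this gap, and
    \<open>t = r' / s\<close> stays below 1.\<close>
  define s where "s = (r' + r) / 2"
  have s: "r' < s" "s < r" "0 < s" using assms by (auto simp: s_def)
  define t where "t = r' / s"
  have t: "0 < t" "t < 1" using s assms by (auto simp: t_def)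
  have "norm (h z) \<le> exp (pi * exp (pi * (2 + 2 * b + 12 * t / (1 - t))))"
    if h: "h holomorphic_on ball p r" "\<And>z. z \<in> ball p r \<Longrightarrow> h z \<noteq> 0 \<and> h z \<noteq> 1"
      "norm (h p) \<le> b" and z: "z \<in> cball p r'" for h z
  proof -
    have sub: "p + of_real s * w \<in> ball p r" if "w \<in> cball 0 1" for w
    proof -
      have "s * norm w \<le> s" using that s mult_left_le by auto
      then have "s * norm w < r" using s by linarith
      then show ?thesis using s by (simp add: dist_norm norm_mult)
    qed
    have "(h \<circ> (\<lambda>w. p + of_real s * w)) holomorphic_on cball 0 1"
      using sub by (intro holomorphic_on_compose_gen[OF _ h(1)] holomorphic_intros) auto
    then have "norm (h (p + of_real s * ((z - p) / of_real s)))
        \<le> exp (pi * exp (pi * (2 + 2 * b + 12 * t / (1 - t))))"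
      using Schottky[of "h \<circ> (\<lambda>w. p + of_real s * w)" b t "(z - p) / of_real s"] h sub z s t
      by (auto simp: t_def norm_divide divide_right_mono dist_norm norm_minus_commute)
    then show ?thesis using s by simp
  qed
  then show ?thesis using that by blast
qed

text \<open>The affine map taking \<open>c\<^sub>1\<close>, \<open>c\<^sub>2\<close> to 0, 1 reduces
  this to Schottky's theorem. With moduli \<open>a\<close> and \<open>2 * a\<close> the distance
  between the two points lies between \<open>a\<close> and \<open>3 * a\<close>, so \<open>C\<close>
  depends neither on the scale \<open>a\<close> nor on the position of the points on their
  circles.\<close>

lemma Schottky_sphere:
  fixes p :: complex
  assumes "0 < r'" "r' < r"
  obtains C where "1 \<le> C"
    "\<And>h a z c\<^sub>1 c\<^sub>2. \<lbrakk>h holomorphic_on ball p r; 0 < a; norm (h p) \<le> a;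
       norm c\<^sub>1 = a; norm c\<^sub>2 = 2 * a; c\<^sub>1 \<notin> h ` ball p r; c\<^sub>2 \<notin> h ` ball p r;
       z \<in> cball p r'\<rbrakk> \<Longrightarrow> norm (h z) \<le> C * a"
proof -
  obtain B where B: "\<And>h z. \<lbrakk>h holomorphic_on ball p r;
      \<And>z. z \<in> ball p r \<Longrightarrow> h z \<noteq> 0 \<and> h z \<noteq> 1; norm (h p) \<le> 2; z \<in> cball p r'\<rbrakk>
      \<Longrightarrow> norm (h z) \<le> B"
    using Schottky_ball[OF assms, of p 2] by blast
  \<comment> \<open>The three terms are |c1| = \<open>a\<close>, the factor \<open>3 * a\<close>
    bounding |c2 - c1|, and Schottky's bound \<open>B\<close>. The latter was taken for centre value
    at most 2, since |h p - c1| <= 2a <= 2 |c2 - c1|; \<open>max B 0\<close> only secures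
    nonnegativity.\<close>
  have "norm (h z) \<le> (1 + 3 * max B 0) * a"
    if h: "h holomorphic_on ball p r" "0 < a" "norm (h p) \<le> a"
       "norm c\<^sub>1 = a" "norm c\<^sub>2 = 2 * a" "c\<^sub>1 \<notin> h ` ball p r" "c\<^sub>2 \<notin> h ` ball p r"
       "z \<in> cball p r'" for h a z c\<^sub>1 c\<^sub>2
  proof -
    have lo: "a \<le> norm (c\<^sub>2 - c\<^sub>1)" using norm_triangle_ineq2[of c\<^sub>2 c\<^sub>1] h by simp
    have hi: "norm (c\<^sub>2 - c\<^sub>1) \<le> 3 * a" using norm_triangle_ineq4[of c\<^sub>2 c\<^sub>1] h by simp
    have ne: "c\<^sub>2 \<noteq> c\<^sub>1" using h by auto
    define g where "g z = (h z - c\<^sub>1) / (c\<^sub>2 - c\<^sub>1)" for z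
    have "norm (h p - c\<^sub>1) \<le> 2 * a" using norm_triangle_ineq4[of "h p" c\<^sub>1] h by simp
    also have "\<dots> \<le> 2 * norm (c\<^sub>2 - c\<^sub>1)" using lo by simp
    finally have gp: "norm (g p) \<le> 2"
      using ne by (simp add: g_def norm_divide pos_divide_le_eq)
    have "norm (g z) \<le> B"
    proof (rule B[of g z])
      show "g holomorphic_on ball p r"
        unfolding g_def using ne by (intro holomorphic_intros h(1)) auto
      show "g z \<noteq> 0 \<and> g z \<noteq> 1" if "z \<in> ball p r" for z
        using imageI[OF that, of h] h(6,7) ne by (auto simp: g_def)
    qed (use gp h in auto)
    then have "norm (g z) * norm (c\<^sub>2 - c\<^sub>1) \<le> max B 0 * (3 * a)"
      using hi by (intro mult_mono) auto
    moreover have "h z = c\<^sub>1 + g z * (c\<^sub>2 - c\<^sub>1)" using ne by (simp add: g_def)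
    then have "norm (h z) \<le> norm c\<^sub>1 + norm (g z) * norm (c\<^sub>2 - c\<^sub>1)"
      by (metis norm_mult norm_triangle_ineq)
    ultimately show ?thesis using h by (simp add: algebra_simps)
  qed
  then show ?thesis using that[of "1 + 3 * max B 0"] by auto
qed

section \<open>Montel's theorem for omitted values that move with the index\<close>

definition tends_normally :: "(nat \<Rightarrow> complex \<Rightarrow> complex) \<Rightarrow> complex set \<Rightarrow> bool" where
  "tends_normally \<phi> U \<longleftrightarrow>
     (\<exists>g. \<forall>K. compact K \<and> K \<subseteq> U \<longrightarrow> uniform_limit K \<phi> g sequentially) \<or>
     (\<forall>K. compact K \<and> K \<subseteq> U \<longrightarrow> (\<forall>B. \<forall>\<^sub>F n in sequentially. \<forall>z\<in>K. norm (\<phi> n z) > B))"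

lemma normal_family_altdef:
  "normal_family \<F> U \<longleftrightarrow>
     (\<forall>\<phi>. range \<phi> \<subseteq> \<F> \<longrightarrow> (\<exists>r :: nat \<Rightarrow> nat. strict_mono r \<and> tends_normally (\<phi> \<circ> r) U))"
  unfolding normal_family_def tends_normally_def by simp

lemma compact_subset_smaller_cball:
  fixes p :: complex
  assumes "compact K" "K \<subseteq> ball p r" "0 < r"
  obtains r' where "0 < r'" "r' < r" "K \<subseteq> cball p r'"
proof (cases "K = {}")
  case True
  then show ?thesis using that[of "r/2"] assms by auto
next
  case False
  obtain x where x: "x \<in> K" "\<And>y. y \<in> K \<Longrightarrow> dist p y \<le> dist p x"
    using distance_attains_sup[OF assms(1) False, of p] by blast
  have "dist p x < r" using x(1) assms(2) by auto
  then show ?thesis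
    using x assms(3) by (intro that[of "max (dist p x) (r/2)"]) (auto simp: le_max_iff_disj)
qed

lemma locally_bounded_tends_normally:
  assumes "open U" "\<And>n. h n holomorphic_on U"
    and "\<And>K. \<lbrakk>compact K; K \<subseteq> U\<rbrakk> \<Longrightarrow> \<exists>B. \<forall>n. \<forall>z\<in>K. norm (h n z) \<le> B"
  obtains s :: "nat \<Rightarrow> nat" where "strict_mono s" "tends_normally (h \<circ> s) U"
proof -
  obtain g s where "strict_mono (s :: nat \<Rightarrow> nat)"
      "\<And>K. \<lbrakk>compact K; K \<subseteq> U\<rbrakk> \<Longrightarrow> uniform_limit K (h \<circ> s) g sequentially"
  proof (rule Montel[OF assms(1), of "range h" h])
    show "\<exists>B. \<forall>h\<in>range h. \<forall>z\<in>K. cmod (h z) \<le> B" if "compact K" "K \<subseteq> U" for K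
      using assms(3)[OF that] by auto
  qed (use assms(2) in auto)
  then show ?thesis using that unfolding tends_normally_def by blast
qed

text \<open>Normalising the omitted values to 0 and 1 gives functions \<open>F n\<close>; since |c2
  - c1| stays between \<open>R\<close> and \<open>3 * R\<close>, boundedness and divergence to
  infinity pass between \<open>F n\<close> and \<open>h n\<close>. The targets may depend on
  \<open>n\<close>, so only the radii of their circles have to be known.\<close>

lemma Montel_moving_targets:
  fixes h :: "nat \<Rightarrow> complex \<Rightarrow> complex"
  assumes "0 < r" "0 < R" and hol: "\<And>n. h n holomorphic_on ball p r"
    and c\<^sub>1: "\<And>n. norm (c\<^sub>1 n) = R" "\<And>n. c\<^sub>1 n \<notin> h n ` ball p r"
    and c\<^sub>2: "\<And>n. norm (c\<^sub>2 n) = 2 * R" "\<And>n. c\<^sub>2 n \<notin> h n ` ball p r"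
  obtains s :: "nat \<Rightarrow> nat" where "strict_mono s" "tends_normally (h \<circ> s) (ball p r)"
proof -
  have lo: "R \<le> norm (c\<^sub>2 n - c\<^sub>1 n)" for n
    using norm_triangle_ineq2[of "c\<^sub>2 n" "c\<^sub>1 n"] c\<^sub>1 c\<^sub>2 by simp
  have hi: "norm (c\<^sub>2 n - c\<^sub>1 n) \<le> 3 * R" for n
    using norm_triangle_ineq4[of "c\<^sub>2 n" "c\<^sub>1 n"] c\<^sub>1 c\<^sub>2 by simp
  have ne: "c\<^sub>2 n \<noteq> c\<^sub>1 n" for n using lo[of n] \<open>0 < R\<close> by auto
  define F where "F n z = (h n z - c\<^sub>1 n) / (c\<^sub>2 n - c\<^sub>1 n)" for n z
  have F: "F n holomorphic_on ball p r" for n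
    unfolding F_def using ne by (intro holomorphic_intros hol) auto
  have F01: "F n z \<noteq> 0 \<and> F n z \<noteq> 1" if "z \<in> ball p r" for n z
    using imageI[OF that, of "h n"] c\<^sub>1(2)[of n] c\<^sub>2(2)[of n] ne[of n] by (auto simp: F_def)
  have hF: "h n z = c\<^sub>1 n + F n z * (c\<^sub>2 n - c\<^sub>1 n)" for n z
    using ne by (simp add: F_def)
  show ?thesis
  \<comment> \<open>If the values \<open>F n p\<close> are bounded along a subsequence, Schottky's
    theorem bounds that subsequence locally. Otherwise \<open>F n p\<close> tends to infinity, and
    the reciprocals are treated instead.\<close>
  proof (cases "\<exists>b. \<exists>\<^sub>\<infinity>n. norm (F n p) \<le> b")
    case True
    then obtain b where b: "\<exists>\<^sub>\<infinity>n. norm (F n p) \<le> b" by blast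
    obtain s :: "nat \<Rightarrow> nat" where s: "strict_mono s" "\<And>n. norm (F (s n) p) \<le> b"
      using infinite_enumerate[OF b[unfolded frequently_cofinite]] by auto
    have "\<exists>B. \<forall>n. \<forall>z\<in>K. norm ((h \<circ> s) n z) \<le> B" if K: "compact K" "K \<subseteq> ball p r" for K
    proof -
      obtain r' where r': "0 < r'" "r' < r" "K \<subseteq> cball p r'"
        using compact_subset_smaller_cball[OF K \<open>0 < r\<close>] .
      obtain B where B: "\<And>h z. \<lbrakk>h holomorphic_on ball p r;
          \<And>z. z \<in> ball p r \<Longrightarrow> h z \<noteq> 0 \<and> h z \<noteq> 1; norm (h p) \<le> b; z \<in> cball p r'\<rbrakk>
          \<Longrightarrow> norm (h z) \<le> B"
        using Schottky_ball[OF r'(1,2), of p b] by blast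
      have "norm ((h \<circ> s) n z) \<le> R + max B 0 * (3 * R)" if "z \<in> K" for n z
      proof -
        have "norm (F (s n) z) \<le> B"
          by (rule B[of "F (s n)" z]) (use F F01 s that r' in auto)
        then have "norm (F (s n) z) * norm (c\<^sub>2 (s n) - c\<^sub>1 (s n)) \<le> max B 0 * (3 * R)"
          using hi by (intro mult_mono) auto
        then show ?thesis
          using norm_triangle_ineq[of "c\<^sub>1 (s n)" "F (s n) z * (c\<^sub>2 (s n) - c\<^sub>1 (s n))"] c\<^sub>1(1)
          by (simp add: hF norm_mult)
      qed
      then show ?thesis by blast
    qed
    note bd = this
    obtain s' :: "nat \<Rightarrow> nat" where "strict_mono s'" "tends_normally ((h \<circ> s) \<circ> s') (ball p r)"
      by (rule locally_bounded_tends_normally[OF open_ball, of "h \<circ> s" p r]) (use hol bd in auto)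
    then show ?thesis
      using that[of "s \<circ> s'"] s(1) by (simp add: strict_mono_o o_assoc)
  next
    case False
    then have "\<not> (\<exists>\<^sub>\<infinity>n. norm (F n p) \<le> b)" for b by blast
    then have big: "\<forall>\<^sub>F n in sequentially. norm (F n p) > b" for b
      by (simp add: not_frequently cofinite_eq_sequentially not_le)
    then obtain N where N: "\<And>n. n \<ge> N \<Longrightarrow> norm (F n p) > 1"
      unfolding eventually_sequentially by blast
    \<comment> \<open>Reciprocals omit 0 and 1 as well. The shift by \<open>N\<close> discards the
      indices at which the value at \<open>p\<close> might exceed 1.\<close>
    define G where "G n z = 1 / F (n + N) z" for n z
    have G: "G n holomorphic_on ball p r" for n
      unfolding G_def using F01 by (intro holomorphic_intros F) auto
    have G01: "G n z \<noteq> 0 \<and> G n z \<noteq> 1" if "z \<in> ball p r" for n z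
      using F01[OF that, of "n+N"] by (auto simp: G_def)
    have Gp: "norm (G n p) \<le> 1" for n
      using N[of "n+N"] by (simp add: G_def norm_divide divide_le_eq)
    have Gbd: "\<exists>B. \<forall>g\<in>range G. \<forall>z\<in>K. norm (g z) \<le> B" if K: "compact K" "K \<subseteq> ball p r" for K
    proof -
      obtain r' where r': "0 < r'" "r' < r" "K \<subseteq> cball p r'"
        using compact_subset_smaller_cball[OF K \<open>0 < r\<close>] .
      obtain B where B: "\<And>h z. \<lbrakk>h holomorphic_on ball p r;
          \<And>z. z \<in> ball p r \<Longrightarrow> h z \<noteq> 0 \<and> h z \<noteq> 1; norm (h p) \<le> 1; z \<in> cball p r'\<rbrakk>
          \<Longrightarrow> norm (h z) \<le> B"
        using Schottky_ball[OF r'(1,2), of p 1] by blast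
      have "norm (G n z) \<le> B" if "z \<in> K" for n z
        by (rule B[of "G n" z]) (use G G01 Gp that r' in auto)
      then show ?thesis by blast
    qed
    obtain g s where g: "g holomorphic_on ball p r" and s: "strict_mono (s :: nat \<Rightarrow> nat)"
      and pt: "\<And>x. x \<in> ball p r \<Longrightarrow> (\<lambda>n. G (s n) x) \<longlonglongrightarrow> g x"
      and ul: "\<And>K. \<lbrakk>compact K; K \<subseteq> ball p r\<rbrakk> \<Longrightarrow> uniform_limit K (G \<circ> s) g sequentially"
      by (rule Montel[OF open_ball, of "range G" p r G]) (use G Gbd in auto)
    have "filterlim (\<lambda>n. F n p) at_infinity sequentially"
      unfolding filterlim_at_infinity[OF order_refl]
      using big by (auto intro: eventually_mono order_less_imp_le)
    then have "(\<lambda>n. 1 / F n p) \<longlonglongrightarrow> 0"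
      by (intro tendsto_divide_0[OF tendsto_const])
    then have "(\<lambda>n. G n p) \<longlonglongrightarrow> 0"
      unfolding G_def by (rule LIMSEQ_ignore_initial_segment)
    then have "(\<lambda>n. G (s n) p) \<longlonglongrightarrow> 0"
      using LIMSEQ_subseq_LIMSEQ[OF _ s] unfolding o_def by blast
    then have gp: "g p = 0"
      using pt[of p] \<open>0 < r\<close> LIMSEQ_unique by auto
    \<comment> \<open>The limit vanishes at \<open>p\<close> although no \<open>G n\<close> has a
      zero; by Hurwitz's theorem it must be identically zero.\<close>
    have g0: "g z = 0" if "z \<in> ball p r" for z
    proof (rule ccontr)
      assume "g z \<noteq> 0"
      then have nc: "\<not> g constant_on ball p r"
        using gp that \<open>0 < r\<close> unfolding constant_on_def
        by (metis centre_in_ball)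
      have "g p \<noteq> 0"
      proof (rule Hurwitz_no_zeros[OF open_ball convex_connected[OF convex_ball] _ g _ nc])
        show "(G \<circ> s) n holomorphic_on ball p r" for n using G by simp
        show "uniform_limit K (G \<circ> s) g sequentially" if "compact K" "K \<subseteq> ball p r" for K
          using ul that .
        show "(G \<circ> s) n z \<noteq> 0" if "z \<in> ball p r" for n z using G01[OF that] by simp
        show "p \<in> ball p r" using \<open>0 < r\<close> by simp
      qed
      with gp show False by simp
    qed
    define s' where "s' n = s n + N" for n
    have "strict_mono s'" using s by (auto simp: s'_def strict_mono_def)
    moreover have "\<forall>\<^sub>F n in sequentially. \<forall>z\<in>K. norm (h (s' n) z) > B"
      if K: "compact K" "K \<subseteq> ball p r" for K B
    proof -
      \<comment> \<open>Chosen so that \<open>R / e\<close> equals |B| + R + 1: the factor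
        \<open>R\<close> is the lower bound for |c2 - c1|, and subtracting |c1| = \<open>R\<close>
        still leaves more than \<open>B\<close>.\<close>
      define e where "e = R / (\<bar>B\<bar> + R + 1)"
      have e: "0 < e" using \<open>0 < R\<close> by (auto simp: e_def)
      have "\<forall>\<^sub>F n in sequentially. \<forall>z\<in>K. dist ((G \<circ> s) n z) (g z) < e"
        using ul[OF K] e unfolding uniform_limit_iff by blast
      then show ?thesis
      proof (rule eventually_mono, intro ballI)
        fix n z assume *: "\<forall>z\<in>K. dist ((G \<circ> s) n z) (g z) < e" and z: "z \<in> K"
        have zb: "z \<in> ball p r" using z K by blast
        have "norm (G (s n) z) < e" using * z g0[OF zb] by auto
        then have "1 / e < norm (F (s' n) z)"
          using F01[OF zb, of "s' n"] e
          by (simp add: G_def s'_def norm_divide field_simps)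
        then have "(1/e) * R \<le> norm (F (s' n) z) * norm (c\<^sub>2 (s' n) - c\<^sub>1 (s' n))"
          using lo e \<open>0 < R\<close> by (intro mult_mono) auto
        then have "\<bar>B\<bar> + R + 1 \<le> norm (h (s' n) z - c\<^sub>1 (s' n))"
          using \<open>0 < R\<close> by (simp add: hF norm_mult e_def)
        also have "\<dots> \<le> norm (h (s' n) z) + R"
          using norm_triangle_ineq4 c\<^sub>1(1) by metis
        finally show "norm (h (s' n) z) > B" by linarith
      qed
    qed
    ultimately show ?thesis
      using that[of s'] unfolding tends_normally_def by auto
  qed
qed

subsection \<open>Normality of iterates\<close>

lemma holomorphic_funpow:
  assumes "f holomorphic_on UNIV"
  shows "(f ^^ n) holomorphic_on A"
proof (induction n)
  case (Suc n)
  then have "(f \<circ> f ^^ n) holomorphic_on A"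
    using assms by (intro holomorphic_on_compose_gen[of _ _ _ UNIV]) auto
  then show ?case by (simp add: o_def)
qed (simp add: id_def)

lemma ball_subset_Fatou_set:
  assumes "0 < r"
    and "\<And>n. \<lbrakk>\<And>j. 1 \<le> n j\<rbrakk> \<Longrightarrow>
      \<exists>s :: nat \<Rightarrow> nat. strict_mono s \<and> tends_normally ((\<lambda>j. f ^^ n j) \<circ> s) (ball p r)"
  shows "ball p r \<subseteq> Fatou_set f"
proof -
  have "normal_family {f ^^ n |n. n \<ge> 1} (ball p r)"
    unfolding normal_family_altdef
  proof (intro allI impI)
    fix \<phi> :: "nat \<Rightarrow> complex \<Rightarrow> complex" assume "range \<phi> \<subseteq> {f ^^ n |n. n \<ge> 1}"
    then have "\<forall>j. \<exists>n. n \<ge> 1 \<and> \<phi> j = f ^^ n" by blast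
    then obtain n where n: "\<And>j. n j \<ge> 1" "\<phi> = (\<lambda>j. f ^^ n j)" by metis
    show "\<exists>s. strict_mono s \<and> tends_normally (\<phi> \<circ> s) (ball p r)"
      using assms(2)[OF n(1)] n(2) by simp
  qed
  then show ?thesis
    unfolding Fatou_set_def by blast
qed

lemma bounded_iterates_subset_Fatou_set:
  assumes "f holomorphic_on UNIV" "0 < r"
    and bd: "\<And>n z. \<lbrakk>1 \<le> n; z \<in> ball p r\<rbrakk> \<Longrightarrow> norm ((f ^^ n) z) \<le> B"
  shows "ball p r \<subseteq> Fatou_set f"
proof (rule ball_subset_Fatou_set[OF \<open>0 < r\<close>])
  fix n :: "nat \<Rightarrow> nat" assume n: "\<And>j. 1 \<le> n j"
  have *: "\<exists>B. \<forall>j. \<forall>z\<in>K. norm ((f ^^ n j) z) \<le> B" if "K \<subseteq> ball p r" for K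
    using bd[OF n] that by (intro exI[of _ B]) auto
  show "\<exists>s :: nat \<Rightarrow> nat. strict_mono s \<and> tends_normally ((\<lambda>j. f ^^ n j) \<circ> s) (ball p r)"
    by (rule locally_bounded_tends_normally[OF open_ball, of "\<lambda>j. f ^^ n j" p r])
       (use holomorphic_funpow[OF assms(1)] * in auto)
qed

text \<open>If no iterate covered such a circle, every iterate would omit a value of modulus
  \<open>R\<close> and one of modulus \<open>2 * R\<close> on the disc, and Montel's theorem with
  moving targets would put the disc into the Fatou set.\<close>

lemma iterate_covers_sphere:
  assumes "f holomorphic_on UNIV" "0 < r" "ball c r \<inter> Julia_set f \<noteq> {}" "0 < R"
  obtains m R' where "1 \<le> m" "R \<le> R'" "sphere 0 R' \<subseteq> (f ^^ m) ` ball c r"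
proof -
  have "\<exists>m R'. 1 \<le> m \<and> R \<le> R' \<and> sphere 0 R' \<subseteq> (f ^^ m) ` ball c r"
  proof (rule ccontr)
    assume no: "\<not> ?thesis"
    have "\<exists>w. norm w = R' \<and> w \<notin> (f ^^ m) ` ball c r" if "1 \<le> m" "R \<le> R'" for m R'
    proof -
      have "\<not> sphere 0 R' \<subseteq> (f ^^ m) ` ball c r" using no that by blast
      then show ?thesis by auto
    qed
    then have om: "\<exists>w. norm w = R \<and> w \<notin> (f ^^ m) ` ball c r"
        "\<exists>w. norm w = 2 * R \<and> w \<notin> (f ^^ m) ` ball c r" if "1 \<le> m" for m
      using that \<open>0 < R\<close> by force+
    have "ball c r \<subseteq> Fatou_set f"
    proof (rule ball_subset_Fatou_set[OF \<open>0 < r\<close>])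
      fix n :: "nat \<Rightarrow> nat" assume n: "\<And>j. 1 \<le> n j"
      obtain c\<^sub>1 where c\<^sub>1: "\<And>j. norm (c\<^sub>1 j) = R \<and> c\<^sub>1 j \<notin> (f ^^ n j) ` ball c r"
        using om(1)[OF n] by metis
      obtain c\<^sub>2 where c\<^sub>2: "\<And>j. norm (c\<^sub>2 j) = 2 * R \<and> c\<^sub>2 j \<notin> (f ^^ n j) ` ball c r"
        using om(2)[OF n] by metis
      show "\<exists>s :: nat \<Rightarrow> nat. strict_mono s \<and> tends_normally ((\<lambda>j. f ^^ n j) \<circ> s) (ball c r)"
        by (rule Montel_moving_targets[of r R "\<lambda>j. f ^^ n j" c c\<^sub>1 c\<^sub>2])
           (use assms c\<^sub>1 c\<^sub>2 holomorphic_funpow[OF assms(1)] in auto)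
    qed
    then show False using assms(3) unfolding Julia_set_def by blast
  qed
  then show ?thesis using that by blast
qed

section \<open>The bounded-or-escaping dichotomy on compact subsets of the Fatou set\<close>

lemma uniform_limit_bounded_eventually:
  fixes \<phi> :: "nat \<Rightarrow> complex \<Rightarrow> complex"
  assumes "compact K" "\<And>n. continuous_on K (\<phi> n)" "uniform_limit K \<phi> g sequentially"
  obtains B where "\<forall>\<^sub>F n in sequentially. \<forall>z\<in>K. norm (\<phi> n z) \<le> B"
proof -
  have "continuous_on K g"
    by (rule uniform_limit_theorem[OF _ assms(3)]) (use assms(2) in auto)
  then have "bounded (g ` K)" using assms(1) compact_continuous_image compact_imp_bounded by blast
  then obtain B where B: "\<And>z. z \<in> K \<Longrightarrow> norm (g z) \<le> B" by (auto simp: bounded_iff)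
  have "\<forall>\<^sub>F n in sequentially. \<forall>z\<in>K. dist (\<phi> n z) (g z) < 1"
    using assms(3) unfolding uniform_limit_iff by simp
  then have "\<forall>\<^sub>F n in sequentially. \<forall>z\<in>K. norm (\<phi> n z) \<le> B + 1"
  proof (rule eventually_mono, intro ballI)
    fix n z assume "\<forall>z\<in>K. dist (\<phi> n z) (g z) < 1" "z \<in> K"
    then show "norm (\<phi> n z) \<le> B + 1"
      using B[of z] norm_triangle_sub[of "\<phi> n z" "g z"] by (force simp: dist_norm)
  qed
  then show ?thesis using that by blast
qed

text \<open>Induction on \<open>Z\<close>: normality at each new point thins out the index sequence
  once more, and both alternatives, being eventual statements, survive at the earlier
  points.\<close>

lemma Fatou_dichotomy_finite:
  assumes f: "f holomorphic_on UNIV" and "finite Z" and n: "\<And>j :: nat. 1 \<le> n j"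
    and U: "\<And>z. z \<in> Z \<Longrightarrow> normal_family {f ^^ n |n. n \<ge> 1} (U z)"
    and Q: "\<And>z. z \<in> Z \<Longrightarrow> compact (Q z) \<and> Q z \<subseteq> U z"
  shows "\<exists>s :: nat \<Rightarrow> nat. strict_mono s \<and> (\<forall>z\<in>Z.
     (\<exists>B. \<forall>\<^sub>F j in sequentially. \<forall>w\<in>Q z. norm ((f ^^ n (s j)) w) \<le> B) \<or>
     (\<forall>B. \<forall>\<^sub>F j in sequentially. \<forall>w\<in>Q z. norm ((f ^^ n (s j)) w) > B))"
  using \<open>finite Z\<close> U Q
proof (induction Z rule: finite_induct)
  case empty
  show ?case using strict_mono_id by auto
next
  case (insert x Z)
  obtain s :: "nat \<Rightarrow> nat" where s: "strict_mono s" "\<And>z. z \<in> Z \<Longrightarrow>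
     (\<exists>B. \<forall>\<^sub>F j in sequentially. \<forall>w\<in>Q z. norm ((f ^^ n (s j)) w) \<le> B) \<or>
     (\<forall>B. \<forall>\<^sub>F j in sequentially. \<forall>w\<in>Q z. norm ((f ^^ n (s j)) w) > B)"
    using insert.IH insert.prems by auto
  have "range (\<lambda>j. f ^^ n (s j)) \<subseteq> {f ^^ n |n. n \<ge> 1}" using n by auto
  then obtain r :: "nat \<Rightarrow> nat" where r: "strict_mono r"
      "tends_normally ((\<lambda>j. f ^^ n (s j)) \<circ> r) (U x)"
    using insert.prems(1)[of x] unfolding normal_family_altdef by blast
  have sub: "\<forall>\<^sub>F j in sequentially. P (r j)" if "\<forall>\<^sub>F j in sequentially. P j" for P
    using that r(1) by (rule eventually_subseq[rotated])
  have "(\<exists>B. \<forall>\<^sub>F j in sequentially. \<forall>w\<in>Q x. norm ((f ^^ n (s (r j))) w) \<le> B) \<or>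
     (\<forall>B. \<forall>\<^sub>F j in sequentially. \<forall>w\<in>Q x. norm ((f ^^ n (s (r j))) w) > B)"
    using r(2) unfolding tends_normally_def
  proof (elim disjE exE)
    fix g assume "\<forall>K. compact K \<and> K \<subseteq> U x \<longrightarrow>
      uniform_limit K ((\<lambda>j. f ^^ n (s j)) \<circ> r) g sequentially"
    then have "uniform_limit (Q x) ((\<lambda>j. f ^^ n (s j)) \<circ> r) g sequentially"
      using insert.prems(2) by blast
    then show ?thesis
      using uniform_limit_bounded_eventually[of "Q x" "(\<lambda>j. f ^^ n (s j)) \<circ> r" g]
        insert.prems(2)[of x] holomorphic_on_imp_continuous_on[OF holomorphic_funpow[OF f]]
      by (auto simp: o_def)
  next
    assume "\<forall>K. compact K \<and> K \<subseteq> U x \<longrightarrow> (\<forall>B. \<forall>\<^sub>F j in sequentially.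
      \<forall>z\<in>K. norm (((\<lambda>j. f ^^ n (s j)) \<circ> r) j z) > B)"
    then show ?thesis using insert.prems(2)[of x] by auto
  qed
  moreover have "(\<exists>B. \<forall>\<^sub>F j in sequentially. \<forall>w\<in>Q z. norm ((f ^^ n (s (r j))) w) \<le> B) \<or>
     (\<forall>B. \<forall>\<^sub>F j in sequentially. \<forall>w\<in>Q z. norm ((f ^^ n (s (r j))) w) > B)" if "z \<in> Z" for z
    using s(2)[OF that]
  proof (elim disjE exE)
    fix B assume "\<forall>\<^sub>F j in sequentially. \<forall>w\<in>Q z. norm ((f ^^ n (s j)) w) \<le> B"
    from sub[OF this] show ?thesis by blast
  next
    assume "\<forall>B. \<forall>\<^sub>F j in sequentially. \<forall>w\<in>Q z. norm ((f ^^ n (s j)) w) > B"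
    then have "\<forall>\<^sub>F j in sequentially. \<forall>w\<in>Q z. norm ((f ^^ n (s (r j))) w) > B" for B
      by (intro sub) blast
    then show ?thesis by blast
  qed
  ultimately show ?case
    using strict_mono_o[OF s(1) r(1)] by (intro exI[of _ "s \<circ> r"]) (simp add: o_def)
qed

text \<open>A finite subcover reduces the choice to finitely many discs. Discs on which the iterates
  stay bounded cannot meet discs on which they escape, so connectedness leaves one behaviour on all
  of \<open>K\<close>. In the escaping case it extends to a neighbourhood of uniform width, which
  Harnack's inequality will need.\<close>

lemma Fatou_dichotomy_compact:
  assumes f: "f holomorphic_on UNIV" and K: "compact K" "connected K" "K \<subseteq> Fatou_set f"
    and n: "\<And>j :: nat. 1 \<le> n j"
  obtains s :: "nat \<Rightarrow> nat" and B where "strict_mono s"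
      "\<forall>\<^sub>F j in sequentially. \<forall>z\<in>K. norm ((f ^^ n (s j)) z) \<le> B"
  | s :: "nat \<Rightarrow> nat" and \<delta> where "strict_mono s" "0 < \<delta>"
      "\<And>B. \<forall>\<^sub>F j in sequentially. \<forall>z\<in>K. \<forall>w\<in>ball z \<delta>. norm ((f ^^ n (s j)) w) > B"
proof -
  have "\<forall>z\<in>K. \<exists>U. open U \<and> z \<in> U \<and> normal_family {f ^^ n |n. n \<ge> 1} U"
    using K(3) unfolding Fatou_set_def by auto
  from bchoice[OF this] obtain U where
    U: "\<And>z. z \<in> K \<Longrightarrow> open (U z) \<and> z \<in> U z \<and> normal_family {f ^^ n |n. n \<ge> 1} (U z)"
    by blast
  \<comment> \<open>Discs of radius \<open>e z\<close> will cover \<open>K\<close>, while the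
    alternatives are known on the closed discs of twice that radius; the difference is the room for
    \<open>\<delta>\<close>.\<close>
  have "\<forall>z\<in>K. \<exists>e>0. cball z (2 * e) \<subseteq> U z"
  proof
    fix z assume "z \<in> K"
    then obtain e where "e > 0" "cball z e \<subseteq> U z" using U[of z] open_contains_cball[of "U z"] by blast
    then show "\<exists>e>0. cball z (2 * e) \<subseteq> U z" by (intro exI[of _ "e/2"]) auto
  qed
  from bchoice[OF this] obtain e where
    e: "\<And>z. z \<in> K \<Longrightarrow> e z > 0 \<and> cball z (2 * e z) \<subseteq> U z" by blast
  obtain Z where Z: "Z \<subseteq> K" "finite Z" "K \<subseteq> (\<Union>z\<in>Z. ball z (e z))"
  proof (rule compactE_image[OF K(1), of K "\<lambda>z. ball z (e z)"])
    show "K \<subseteq> (\<Union>z\<in>K. ball z (e z))" using e by fastforce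
  qed auto
  have "\<exists>s :: nat \<Rightarrow> nat. strict_mono s \<and> (\<forall>z\<in>Z.
     (\<exists>B. \<forall>\<^sub>F j in sequentially. \<forall>w\<in>cball z (2 * e z). norm ((f ^^ n (s j)) w) \<le> B) \<or>
     (\<forall>B. \<forall>\<^sub>F j in sequentially. \<forall>w\<in>cball z (2 * e z). norm ((f ^^ n (s j)) w) > B))"
  proof (rule Fatou_dichotomy_finite[OF f Z(2) n])
    show "normal_family {f ^^ n |n. n \<ge> 1} (U z)" if "z \<in> Z" for z
      using U that Z(1) by blast
    show "compact (cball z (2 * e z)) \<and> cball z (2 * e z) \<subseteq> U z" if "z \<in> Z" for z
      using e that Z(1) by auto
  qed
  then obtain s :: "nat \<Rightarrow> nat" where s: "strict_mono s" "\<And>z. z \<in> Z \<Longrightarrow>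
     (\<exists>B. \<forall>\<^sub>F j in sequentially. \<forall>w\<in>cball z (2 * e z). norm ((f ^^ n (s j)) w) \<le> B) \<or>
     (\<forall>B. \<forall>\<^sub>F j in sequentially. \<forall>w\<in>cball z (2 * e z). norm ((f ^^ n (s j)) w) > B)"
    by blast
  define Z\<^sub>1 where "Z\<^sub>1 = {z\<in>Z. \<exists>B. \<forall>\<^sub>F j in sequentially. \<forall>w\<in>cball z (2 * e z). norm ((f ^^ n (s j)) w) \<le> B}"
  define Z\<^sub>2 where "Z\<^sub>2 = {z\<in>Z. \<forall>B. \<forall>\<^sub>F j in sequentially. \<forall>w\<in>cball z (2 * e z). norm ((f ^^ n (s j)) w) > B}"
  have Z12: "Z = Z\<^sub>1 \<union> Z\<^sub>2" using s(2) by (auto simp: Z\<^sub>1_def Z\<^sub>2_def)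
  have fin: "finite Z\<^sub>1" "finite Z\<^sub>2" using Z(2) by (auto simp: Z\<^sub>1_def Z\<^sub>2_def)
  define A\<^sub>1 where "A\<^sub>1 = (\<Union>z\<in>Z\<^sub>1. ball z (e z))"
  define A\<^sub>2 where "A\<^sub>2 = (\<Union>z\<in>Z\<^sub>2. ball z (e z))"
  \<comment> \<open>At a common point the iterates would eventually be both bounded by
    \<open>B\<close> and larger than \<open>B\<close>.\<close>
  have disj: "A\<^sub>1 \<inter> A\<^sub>2 = {}"
  proof (rule ccontr)
    assume "A\<^sub>1 \<inter> A\<^sub>2 \<noteq> {}"
    then obtain w z\<^sub>1 z\<^sub>2 where w: "z\<^sub>1 \<in> Z\<^sub>1" "w \<in> ball z\<^sub>1 (e z\<^sub>1)" "z\<^sub>2 \<in> Z\<^sub>2" "w \<in> ball z\<^sub>2 (e z\<^sub>2)"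
      by (auto simp: A\<^sub>1_def A\<^sub>2_def)
    obtain B where B: "\<forall>\<^sub>F j in sequentially. \<forall>w\<in>cball z\<^sub>1 (2 * e z\<^sub>1). norm ((f ^^ n (s j)) w) \<le> B"
      using w(1) by (auto simp: Z\<^sub>1_def)
    have "\<forall>\<^sub>F j in sequentially. \<forall>w\<in>cball z\<^sub>2 (2 * e z\<^sub>2). norm ((f ^^ n (s j)) w) > B"
      using w(3) by (auto simp: Z\<^sub>2_def)
    with B have "\<forall>\<^sub>F j in sequentially. False"
    proof (rule eventually_elim2)
      fix j assume *: "\<forall>w\<in>cball z\<^sub>1 (2 * e z\<^sub>1). norm ((f ^^ n (s j)) w) \<le> B"
        "\<forall>w\<in>cball z\<^sub>2 (2 * e z\<^sub>2). norm ((f ^^ n (s j)) w) > B"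
      have "e z\<^sub>1 > 0" "e z\<^sub>2 > 0" using w e Z12 Z(1) by auto
      then have "w \<in> cball z\<^sub>1 (2 * e z\<^sub>1)" "w \<in> cball z\<^sub>2 (2 * e z\<^sub>2)" using w by auto
      then show False using * by fastforce
    qed
    then show False by simp
  qed
  have "K \<subseteq> A\<^sub>1 \<union> A\<^sub>2" using Z(3) Z12 by (auto simp: A\<^sub>1_def A\<^sub>2_def)
  moreover have "open A\<^sub>1" "open A\<^sub>2" by (auto simp: A\<^sub>1_def A\<^sub>2_def)
  ultimately consider "K \<subseteq> A\<^sub>1" | "K \<subseteq> A\<^sub>2"
    using connectedD[OF K(2), of A\<^sub>1 A\<^sub>2] disj by blast
  then show ?thesis
  proof cases
    case 1
    have "\<forall>z\<in>Z\<^sub>1. \<exists>B. \<forall>\<^sub>F j in sequentially. \<forall>w\<in>cball z (2 * e z). norm ((f ^^ n (s j)) w) \<le> B"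
      by (auto simp: Z\<^sub>1_def)
    from bchoice[OF this] obtain B where
      "\<forall>z\<in>Z\<^sub>1. \<forall>\<^sub>F j in sequentially. \<forall>w\<in>cball z (2 * e z). norm ((f ^^ n (s j)) w) \<le> B z" ..
    then have "\<forall>\<^sub>F j in sequentially. \<forall>z\<in>Z\<^sub>1. \<forall>w\<in>cball z (2 * e z). norm ((f ^^ n (s j)) w) \<le> B z"
      using fin(1) by (simp add: eventually_ball_finite_distrib)
    then have "\<forall>\<^sub>F j in sequentially. \<forall>w\<in>K. norm ((f ^^ n (s j)) w) \<le> Max (B ` Z\<^sub>1)"
    proof (rule eventually_mono, intro ballI)
      fix j w assume *: "\<forall>z\<in>Z\<^sub>1. \<forall>w\<in>cball z (2 * e z). norm ((f ^^ n (s j)) w) \<le> B z" and w: "w \<in> K"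
      then obtain z where z: "z \<in> Z\<^sub>1" "w \<in> ball z (e z)" using 1 by (auto simp: A\<^sub>1_def)
      moreover have "0 < e z" using z(1) e Z12 Z(1) by auto
      ultimately have "norm ((f ^^ n (s j)) w) \<le> B z" using * by auto
      also have "\<dots> \<le> Max (B ` Z\<^sub>1)" using z(1) fin by simp
      finally show "norm ((f ^^ n (s j)) w) \<le> Max (B ` Z\<^sub>1)" .
    qed
    then show ?thesis using that(1) s(1) by blast
  next
    case 2
    \<comment> \<open>The inserted 1 gives the minimum a value when \<open>Z\<^sub>2\<close> is
      empty, as may happen for empty \<open>K\<close>.\<close>
    define \<delta> where "\<delta> = Min (insert 1 (e ` Z\<^sub>2))"
    have "0 < \<delta>" using fin e Z12 Z(1) by (auto simp: \<delta>_def)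
    moreover have "\<forall>\<^sub>F j in sequentially. \<forall>z\<in>K. \<forall>w\<in>ball z \<delta>. norm ((f ^^ n (s j)) w) > B" for B
    proof -
      have "\<forall>\<^sub>F j in sequentially. \<forall>z\<in>Z\<^sub>2. \<forall>w\<in>cball z (2 * e z). norm ((f ^^ n (s j)) w) > B"
        unfolding eventually_ball_finite_distrib[OF fin(2)] by (auto simp: Z\<^sub>2_def)
      then show ?thesis
      proof (rule eventually_mono, intro ballI)
        fix j x w assume *: "\<forall>z\<in>Z\<^sub>2. \<forall>w\<in>cball z (2 * e z). norm ((f ^^ n (s j)) w) > B"
          and x: "x \<in> K" and w: "w \<in> ball x \<delta>"
        obtain z where z: "z \<in> Z\<^sub>2" "x \<in> ball z (e z)" using 2 x unfolding A\<^sub>2_def by blast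
        have "\<delta> \<le> e z" using z(1) fin by (simp add: \<delta>_def)
        then have "w \<in> cball z (2 * e z)" using w z(2) dist_triangle[of z w x] unfolding mem_ball mem_cball by linarith
        then show "norm ((f ^^ n (s j)) w) > B" using * z(1) by blast
      qed
    qed
    ultimately show ?thesis using that(2) s(1) by blast
  qed
qed

subsection \<open>Growth, Harnack's inequality and Jordan curves\<close>

text \<open>If the bound failed for arbitrarily large radii, Cauchy's estimates on those circles
  would annihilate every Taylor coefficient of order above \<open>N\<close>, and \<open>f\<close>
  would be a polynomial.\<close>

lemma transcendental_growth:
  assumes "transcendental_entire f"
  obtains a\<^sub>0 where "0 < a\<^sub>0" "\<And>a. a\<^sub>0 \<le> a \<Longrightarrow> \<exists>z. norm z = a \<and> A * a ^ N < norm (f z)"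
proof -
  have f: "f holomorphic_on UNIV" and np: "\<not> (\<exists>p. \<forall>z. f z = poly p z)"
    using assms by (auto simp: transcendental_entire_def)
  have "\<exists>a\<^sub>0>0. \<forall>a\<ge>a\<^sub>0. \<exists>z. norm z = a \<and> A * a ^ N < norm (f z)"
  proof (rule ccontr)
    assume "\<not> ?thesis"
    then have small: "\<exists>a\<ge>a\<^sub>0. \<forall>z. norm z = a \<longrightarrow> norm (f z) \<le> A * a ^ N" if "a\<^sub>0 > 0" for a\<^sub>0
      using that by (meson not_le)
    have deriv0: "(deriv ^^ n) f 0 = 0" if "N < n" for n
    proof (rule ccontr)
      assume nz: "(deriv ^^ n) f 0 \<noteq> 0"
      \<comment> \<open>From this radius on, Cauchy's estimate contradicts itself:
        \<open>a\<^sub>0\<close> times the modulus of the derivative exceeds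
        \<open>fact n * \<bar>A\<bar>\<close> by that modulus.\<close>
      define a\<^sub>0 where "a\<^sub>0 = 1 + fact n * \<bar>A\<bar> / norm ((deriv ^^ n) f 0)"
      have "a\<^sub>0 \<ge> 1" by (simp add: a\<^sub>0_def)
      then obtain a where a: "a \<ge> a\<^sub>0" "\<And>z. norm z = a \<Longrightarrow> norm (f z) \<le> A * a ^ N"
        using small[of a\<^sub>0] by auto
      have a1: "a \<ge> 1" using a(1) \<open>a\<^sub>0 \<ge> 1\<close> by simp
      have "norm ((deriv ^^ n) f 0) \<le> fact n * (A * a ^ N) / a ^ n"
        using a a1 by (intro Cauchy_inequality holomorphic_on_subset[OF f]
            holomorphic_on_imp_continuous_on[OF holomorphic_on_subset[OF f]]) auto
      also have "\<dots> \<le> fact n * (\<bar>A\<bar> * a ^ N) / (a ^ N * a)"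
      proof (rule frac_le)
        have "a ^ (N + 1) \<le> a ^ n" using that a1 by (intro power_increasing) auto
        then show "a ^ N * a \<le> a ^ n" by (simp add: mult.commute)
      qed (use a1 in \<open>auto intro!: mult_left_mono mult_right_mono\<close>)
      also have "\<dots> = fact n * \<bar>A\<bar> / a" using a1 by simp
      finally have "a * norm ((deriv ^^ n) f 0) \<le> fact n * \<bar>A\<bar>"
        using a1 by (simp add: pos_le_divide_eq mult.commute)
      moreover have "a\<^sub>0 * norm ((deriv ^^ n) f 0) = norm ((deriv ^^ n) f 0) + fact n * \<bar>A\<bar>"
        using nz by (simp add: a\<^sub>0_def field_simps)
      moreover have "a\<^sub>0 * norm ((deriv ^^ n) f 0) \<le> a * norm ((deriv ^^ n) f 0)"
        using a(1) by (intro mult_right_mono) auto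
      moreover have "0 < norm ((deriv ^^ n) f 0)" using nz by simp
      ultimately show False by linarith
    qed
    have "f w = poly (\<Sum>k\<le>N. monom ((deriv ^^ k) f 0 / fact k) k) w" for w
    proof -
      have "((\<lambda>n. (deriv ^^ n) f 0 / fact n * (w - 0) ^ n) sums f w)"
        by (rule holomorphic_power_series[of f 0 "norm w + 1"])
           (auto intro: holomorphic_on_subset[OF f])
      moreover have "((\<lambda>n. (deriv ^^ n) f 0 / fact n * (w - 0) ^ n) sums
          (\<Sum>n\<le>N. (deriv ^^ n) f 0 / fact n * (w - 0) ^ n))"
        by (rule sums_finite) (auto simp: deriv0)
      ultimately show ?thesis
        by (simp add: sums_unique2 poly_sum poly_monom)
    qed
    then show False using np by blast
  qed
  then show ?thesis using that by blast
qed

text \<open>This is Harnack's inequality for the positive harmonic function log |h|, with constant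
  (1 + 1/2) / (1 - 1/2) = 3 at half the radius. It is derived from the Schwarz lemma applied to a
  holomorphic logarithm \<open>g\<close>, whose real part is positive.\<close>

lemma Harnack_log_modulus:
  assumes h: "h holomorphic_on ball z \<rho>" and gt: "\<And>w. w \<in> ball z \<rho> \<Longrightarrow> 1 < norm (h w)"
    and w: "w \<in> cball z (\<rho> / 2)" and "0 < \<rho>"
  shows "ln (norm (h w)) \<le> 3 * ln (norm (h z))"
proof -
  obtain g where g: "g holomorphic_on ball z \<rho>" "\<And>x. x \<in> ball z \<rho> \<Longrightarrow> h x = exp (g x)"
  proof (rule contractible_imp_holomorphic_log[OF h])
    show "h x \<noteq> 0" if "x \<in> ball z \<rho>" for x using gt[OF that] by auto
  qed (auto simp: convex_imp_contractible)
  have Re: "ln (norm (h x)) = Re (g x)" if "x \<in> ball z \<rho>" for x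
    using g(2)[OF that] by simp
  have pos: "0 < Re (g x)" if "x \<in> ball z \<rho>" for x
    using gt[OF that] g(2)[OF that] by simp
  have zb: "z \<in> ball z \<rho>" using \<open>0 < \<rho>\<close> by simp
  \<comment> \<open>The Moebius map u -> (u - g z) / (u + cnj (g z)) sends the right half-plane to
    the unit disc and \<open>g z\<close> to 0.\<close>
  define q where "q x = (g (z + of_real \<rho> * x) - g z) / (g (z + of_real \<rho> * x) + cnj (g z))" for x
  have in_b: "z + of_real \<rho> * x \<in> ball z \<rho>" if "norm x < 1" for x
    using that \<open>0 < \<rho>\<close> by (simp add: dist_norm norm_mult)
  have den: "g (z + of_real \<rho> * x) + cnj (g z) \<noteq> 0" if "norm x < 1" for x
    using pos[OF in_b[OF that]] pos[OF zb] by (auto simp: complex_eq_iff)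
  have "(g \<circ> (\<lambda>x. z + of_real \<rho> * x)) holomorphic_on ball 0 1"
    using in_b by (intro holomorphic_on_compose_gen[OF _ g(1)] holomorphic_intros) auto
  then have qh: "q holomorphic_on ball 0 1"
    unfolding q_def o_def using den by (intro holomorphic_intros) auto
  have q1: "norm (q x) < 1" if "norm x < 1" for x
  proof -
    let ?u = "g (z + of_real \<rho> * x)"
    have "(Re ?u - Re (g z))\<^sup>2 < (Re ?u + Re (g z))\<^sup>2"
      using mult_pos_pos[OF pos[OF in_b[OF that]] pos[OF zb]]
      by (simp add: power2_eq_square algebra_simps)
    then have "norm (?u - g z) < norm (?u + cnj (g z))"
      unfolding cmod_def by simp
    then show ?thesis using den[OF that] by (simp add: q_def norm_divide)
  qed
  define x where "x = (w - z) / of_real \<rho>"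
  have x: "norm x \<le> 1/2" using w \<open>0 < \<rho>\<close>
    by (simp add: x_def norm_divide dist_norm norm_minus_commute divide_le_eq)
  have wx: "z + of_real \<rho> * x = w" using \<open>0 < \<rho>\<close> by (simp add: x_def)
  \<comment> \<open>The Schwarz bound is now turned into |g w - g z| <= |g w - g z| / 2 + Re (g z),
    which gives Re (g w) <= 3 Re (g z).\<close>
  have "norm (q x) \<le> 1/2"
    using Schwarz_Lemma(1)[OF qh _ q1, of x] x by (simp add: q_def)
  then have "norm (g w - g z) \<le> 1/2 * norm (g w + cnj (g z))"
    using den[of x] x by (simp add: q_def wx norm_divide divide_le_eq)
  also have "g w + cnj (g z) = (g w - g z) + of_real (2 * Re (g z))"
    by (simp add: complex_eq_iff)
  also have "1/2 * norm \<dots> \<le> 1/2 * (norm (g w - g z) + 2 * Re (g z))"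
    using norm_triangle_ineq[of "g w - g z" "of_real (2 * Re (g z))"] pos[OF zb] by simp
  finally have "norm (g w - g z) \<le> 2 * Re (g z)" by simp
  moreover have "Re (g w) - Re (g z) \<le> norm (g w - g z)"
    using complex_Re_le_cmod[of "g w - g z"] by simp
  moreover have "w \<in> ball z \<rho>" using w \<open>0 < \<rho>\<close> by simp
  ultimately show ?thesis using Re zb by simp
qed

text \<open>Uniform continuity cuts the path into \<open>N\<close> pieces whose parameter steps move
  the point by less than half of \<open>\<rho>\<close>. Each step costs a factor 3 in the logarithm,
  so the exponent is \<open>3 ^ N\<close>; it depends on the path and \<open>\<rho>\<close> but not
  on \<open>h\<close>.\<close>

lemma Harnack_path:
  assumes "path g" "0 < \<rho>"
  obtains L :: nat where
    "\<And>h x. \<lbrakk>h holomorphic_on UNIV;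
        \<And>x w. \<lbrakk>x \<in> path_image g; w \<in> ball x \<rho>\<rbrakk> \<Longrightarrow> 1 < norm (h w); x \<in> path_image g\<rbrakk>
      \<Longrightarrow> norm (h x) \<le> norm (h (pathstart g)) ^ L"
proof -
  have "uniformly_continuous_on {0..1} g"
    using assms(1) unfolding path_def by (intro compact_uniformly_continuous) auto
  then obtain d where d: "d > 0"
      "\<And>s t. \<lbrakk>s \<in> {0..1}; t \<in> {0..1}; dist t s < d\<rbrakk> \<Longrightarrow> dist (g t) (g s) < \<rho> / 2"
    unfolding uniformly_continuous_on_def using assms(2) by (metis half_gt_zero)
  obtain N :: nat where N: "1 / d < real N" using reals_Archimedean2 by blast
  then have Npos: "0 < real N" using d(1) by (meson divide_pos_pos less_trans zero_less_one)
  have Nd: "1 / real N < d" using N d(1) Npos by (simp add: field_simps)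
  have "norm (h x) \<le> norm (h (pathstart g)) ^ (3 ^ N)"
    if h: "h holomorphic_on UNIV"
      "\<And>x w. \<lbrakk>x \<in> path_image g; w \<in> ball x \<rho>\<rbrakk> \<Longrightarrow> 1 < norm (h w)" and x: "x \<in> path_image g"
    for h x
  proof -
    have im: "g t \<in> path_image g" if "t \<in> {0..1}" for t using that by (auto simp: path_image_def)
    have gt: "1 < norm (h (g t))" if "t \<in> {0..1}" for t
      using h(2)[OF im[OF that], of "g t"] assms(2) by simp
    have step: "ln (norm (h (g t))) \<le> 3 ^ i * ln (norm (h (g 0)))"
      if "t \<in> {0..1}" "t \<le> i / real N" for t i
      using that
    proof (induction i arbitrary: t)
      case 0
      then have "t = 0" by simp
      then show ?case by simp
    next
      case (Suc i)
      \<comment> \<open>The previous parameter on the path, cut off at 0 so that it stays in the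
        unit interval.\<close>
      define s where "s = max 0 (t - 1 / real N)"
      have "t - 1 / real N \<le> 1"
        using divide_nonneg_pos[OF zero_le_one Npos] Suc.prems(1)
        unfolding atLeastAtMost_iff by linarith
      then have s: "s \<in> {0..1}" "s \<le> i / real N"
        using Suc.prems by (auto simp: s_def max_def add_divide_distrib)
      have "dist t s \<le> 1 / real N"
        using Suc.prems by (auto simp: s_def max_def dist_real_def)
      then have "dist (g t) (g s) < \<rho> / 2" using d(2) s(1) Suc.prems(1) Nd by simp
      then have "g t \<in> cball (g s) (\<rho> / 2)" by (simp add: dist_commute)
      then have "ln (norm (h (g t))) \<le> 3 * ln (norm (h (g s)))"
        by (intro Harnack_log_modulus[where \<rho> = \<rho>] holomorphic_on_subset[OF h(1)])
           (use h(2)[OF im[OF s(1)]] assms(2) in auto)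
      then show ?case using Suc.IH[OF s] by simp
    qed
    obtain t where t: "t \<in> {0..1}" "x = g t" using x by (auto simp: path_image_def)
    have "ln (norm (h x)) \<le> real (3 ^ N) * ln (norm (h (g 0)))"
      using step[of t N] t Npos by simp
    also have "\<dots> = ln (norm (h (g 0)) ^ (3 ^ N))" by (simp only: ln_realpow)
    finally have *: "ln (norm (h x)) \<le> ln (norm (h (g 0)) ^ (3 ^ N))" .
    have "0 < norm (h x)" "0 < norm (h (g 0)) ^ (3 ^ N)"
      using gt[OF t(1)] gt[of 0] t(2) by (force intro: zero_less_power)+
    then have "norm (h x) \<le> norm (h (g 0)) ^ (3 ^ N)"
      using * by (simp only: ln_le_cancel_iff)
    then show ?thesis by (simp add: pathstart_def)
  qed
  then show ?thesis using that by blast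
qed

section \<open>Topology of Jordan curves and their complements\<close>

lemma Jordan_curve_inside:
  assumes "Jordan_curve \<gamma>"
  shows "open (inside \<gamma>)" "bounded (inside \<gamma>)" "frontier (inside \<gamma>) = \<gamma>"
    "connected (- inside \<gamma>)" "\<not> bounded (- inside \<gamma>)"
proof -
  obtain c where c: "simple_path c" "pathfinish c = pathstart c" "path_image c = \<gamma>"
    using assms by (auto simp: Jordan_curve_def)
  note J = Jordan_inside_outside[OF c(1,2), unfolded c(3)]
  show "open (inside \<gamma>)" "bounded (inside \<gamma>)" "frontier (inside \<gamma>) = \<gamma>" using J by auto
  \<comment> \<open>The curve is the common frontier of both sides, so the complement of the inside
    is the closure of the connected outside.\<close>
  have "- inside \<gamma> = outside \<gamma> \<union> frontier (outside \<gamma>)"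
    using J inside_Un_outside[of \<gamma>] inside_Int_outside[of \<gamma>] inside_no_overlap[of \<gamma>] by blast
  then have "- inside \<gamma> = closure (outside \<gamma>)" by (simp add: closure_Un_frontier)
  moreover have "connected (closure (outside \<gamma>))"
    using J by (intro connected_imp_connected_closure) blast
  ultimately show "connected (- inside \<gamma>)" by metis
  have "outside \<gamma> \<subseteq> - inside \<gamma>" using inside_Int_outside[of \<gamma>] by blast
  moreover have "\<not> bounded (outside \<gamma>)" using J by blast
  ultimately show "\<not> bounded (- inside \<gamma>)" using bounded_subset by metis
qed

lemma surrounds_Jordan_curve:
  assumes "Jordan_curve \<gamma>" "surrounds \<gamma> S"
  shows "S \<subseteq> inside \<gamma>"
  using assms inside_Jordan_curve unfolding surrounds_def by blast

lemma surrounds_disjoint: "surrounds \<gamma> S \<Longrightarrow> S \<inter> \<gamma> = {}"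
  unfolding surrounds_def using in_components_subset by blast

text \<open>Applied to the complement of the inside of a Jordan curve, this supplies omitted values
  on prescribed circles from a single omitted value of controlled modulus.\<close>

lemma connected_unbounded_attains_norm:
  fixes Y :: "complex set"
  assumes "connected Y" "\<not> bounded Y" "b \<in> Y" "norm b \<le> R"
  obtains y where "y \<in> Y" "norm y = R"
proof -
  obtain x where x: "x \<in> Y" "R < norm x" using assms(2) unfolding bounded_iff by (meson not_le)
  have "connected (norm ` Y)"
    using assms(1) by (intro connected_continuous_image continuous_intros)
  then have "R \<in> norm ` Y"
    by (rule connectedD_interval[of _ "norm b" "norm x"]) (use assms x in auto)
  then show ?thesis using that by auto
qed

subsection \<open>Unbounded Fatou components\<close>

lemma open_map_funpow:
  assumes "f holomorphic_on UNIV" "\<not> f constant_on UNIV" "open U"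
  shows "open ((f ^^ n) ` U)"
proof (induction n)
  case (Suc n)
  have "open (f ` ((f ^^ n) ` U))"
    by (rule open_mapping_thm[OF assms(1) _ _ Suc _ assms(2)]) auto
  then show ?case by (simp add: image_comp)
qed (use assms in simp)

text \<open>A topological maximum principle. The image of the open disc is open, so its frontier
  lies in the image of the circle and hence inside the curve. The complement of the inside is
  connected and unbounded; it cannot meet the bounded image without meeting that frontier.\<close>

lemma image_ball_subset_inside:
  assumes "Jordan_curve \<gamma>" "h holomorphic_on UNIV" "open (h ` ball 0 R)"
    and "h ` sphere 0 R \<subseteq> inside \<gamma>"
  shows "h ` ball 0 R \<subseteq> inside \<gamma>"
proof (rule ccontr)
  assume "\<not> ?thesis"
  then have ne: "- inside \<gamma> \<inter> h ` ball 0 R \<noteq> {}" by blast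
  have cont: "continuous_on A h" for A
    using assms(2) holomorphic_on_imp_continuous_on holomorphic_on_subset by blast
  have comp: "compact (h ` cball 0 R)" by (intro compact_continuous_image cont compact_cball)
  have sub: "h ` ball 0 R \<subseteq> h ` cball 0 R" by (intro image_mono ball_subset_cball)
  have "\<not> - inside \<gamma> \<subseteq> h ` ball 0 R"
    using Jordan_curve_inside(5)[OF assms(1)] bounded_subset[OF compact_imp_bounded[OF comp] order_trans[OF _ sub]]
    by metis
  then have "- inside \<gamma> \<inter> frontier (h ` ball 0 R) \<noteq> {}"
    using ne by (intro connected_Int_frontier Jordan_curve_inside(4)[OF assms(1)]) auto
  moreover have "frontier (h ` ball 0 R) \<subseteq> h ` cball 0 R - h ` ball 0 R"
    using closure_minimal[OF sub compact_imp_closed[OF comp]] interior_open[OF assms(3)]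
    unfolding frontier_def by blast
  moreover have "h ` cball 0 R - h ` ball 0 R \<subseteq> h ` sphere 0 R" by force
  ultimately show False using assms(4) by blast
qed

text \<open>By induction \<open>(f ^^ k)\<close>
  K\<open>is connected, contains the interior point\<close>(f ^^ k)
  w\<open>and is not contained in the inside, so it crosses\<close>\<gamma>
  k\<open>. The next iterate puts the crossing point on\<close>f \<open>\<gamma> k\<close>, off the
  inside of the next curve.\<close>

lemma path_escapes_inside:
  assumes "f holomorphic_on UNIV" "connected K" "w \<in> K"
    and J: "\<And>k :: nat. Jordan_curve (\<gamma> k)"
    and sur: "\<And>k. surrounds (f ` \<gamma> k) (inside (\<gamma> (Suc k)))"
    and w: "\<And>k. (f ^^ k) w \<in> inside (\<gamma> k)" and "\<not> K \<subseteq> inside (\<gamma> 0)"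
  shows "\<not> (f ^^ k) ` K \<subseteq> inside (\<gamma> k)"
proof (induction k)
  case (Suc k)
  have "connected ((f ^^ k) ` K)"
    using assms(2) holomorphic_on_imp_continuous_on[OF holomorphic_funpow[OF assms(1)]]
    by (rule connected_continuous_image[rotated])
  then have "(f ^^ k) ` K \<inter> frontier (inside (\<gamma> k)) \<noteq> {}"
    using Suc w[of k] \<open>w \<in> K\<close> by (intro connected_Int_frontier) auto
  then obtain x where "x \<in> K" "(f ^^ k) x \<in> \<gamma> k"
    using Jordan_curve_inside(3)[OF J] by auto
  then have "(f ^^ Suc k) x \<in> f ` \<gamma> k" by auto
  then have "(f ^^ Suc k) x \<notin> inside (\<gamma> (Suc k))"
    using surrounds_disjoint[OF sur[of k]] by blast
  then show ?case using \<open>x \<in> K\<close> by blast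
qed (use assms in auto)

text \<open>The image \<^term>\<open>(f ^^ k) ` ball p (2 * r\<^sub>0)\<close> contains a circle of radius comparable to
  \<^term>\<open>norm ((f ^^ k) w)\<close>, and on that circle the transcendental \<^term>\<open>f\<close> exceeds every power of
  the radius; as \<open>f (f\<^sup>k y) = f\<^sup>k (f y)\<close>, large values of \<open>f\<^sup>k\<close> are attained on \<open>X\<close>.\<close>

lemma iterates_outgrow_powers:
  assumes f: "transcendental_entire f" and "0 < r\<^sub>0" and w: "w \<in> cball p r\<^sub>0"
    and M: "f ` cball p (2 * r\<^sub>0) \<subseteq> X" and pbd: "\<And>k. norm ((f ^^ k) p) \<le> b"
  obtains s\<^sub>0 where
    "\<And>k. s\<^sub>0 \<le> norm ((f ^^ k) w) \<Longrightarrow> \<exists>x\<in>X. C * norm ((f ^^ k) w) ^ L < norm ((f ^^ k) x)"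
proof -
  have hol: "f holomorphic_on UNIV" using f by (simp add: transcendental_entire_def)
  obtain D where D: "1 \<le> D"
    "\<And>h a z c\<^sub>1 c\<^sub>2. \<lbrakk>h holomorphic_on ball p (2 * r\<^sub>0); 0 < a; norm (h p) \<le> a;
       norm c\<^sub>1 = a; norm c\<^sub>2 = 2 * a; c\<^sub>1 \<notin> h ` ball p (2 * r\<^sub>0); c\<^sub>2 \<notin> h ` ball p (2 * r\<^sub>0);
       z \<in> cball p r\<^sub>0\<rbrakk> \<Longrightarrow> norm (h z) \<le> D * a"
    using Schottky_sphere[of r\<^sub>0 "2 * r\<^sub>0" p] \<open>0 < r\<^sub>0\<close> by (metis mult_2 less_add_same_cancel1)
  \<comment> \<open>The factor \<open>(2 * D) ^ L\<close> makes up for the passage from |f^k(w)| to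
    the smaller radius \<open>a\<close> chosen below.\<close>
  obtain a\<^sub>0 where a\<^sub>0: "0 < a\<^sub>0"
    "\<And>a. a\<^sub>0 \<le> a \<Longrightarrow> \<exists>z. norm z = a \<and> (\<bar>C\<bar> * (2 * D) ^ L) * a ^ L < norm (f z)"
    using transcendental_growth[OF f, of "\<bar>C\<bar> * (2 * D) ^ L" L] by blast
  have "\<exists>x\<in>X. C * norm ((f ^^ k) w) ^ L < norm ((f ^^ k) x)"
    if s: "2 * D * (a\<^sub>0 + \<bar>b\<bar>) \<le> norm ((f ^^ k) w)" for k
  proof -
    define s where "s = norm ((f ^^ k) w)"
    \<comment> \<open>With this radius \<open>D * a\<close> is half of \<open>s\<close>, so
      Schottky's conclusion fails at \<open>w\<close>. One of the circles of radius \<open>a\<close>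
      and \<open>2 * a\<close> must therefore be covered.\<close>
    define a where "a = s / (2 * D)"
    have a: "a\<^sub>0 + \<bar>b\<bar> \<le> a" using that D(1) by (simp add: a_def s_def field_simps)
    have "b \<le> \<bar>b\<bar>" "0 \<le> \<bar>b\<bar>" by simp_all
    with a a\<^sub>0(1) pbd[of k] have apos: "0 < a" "a\<^sub>0 \<le> a" "norm ((f ^^ k) p) \<le> a"
      by linarith+
    have sa: "s = 2 * (D * a)" using D(1) unfolding a_def by simp
    have "0 < D * a" using apos D(1) by simp
    then have "D * a < norm ((f ^^ k) w)" using sa unfolding s_def by linarith
    have "sphere 0 a \<subseteq> (f ^^ k) ` ball p (2 * r\<^sub>0) \<or>
        sphere 0 (2 * a) \<subseteq> (f ^^ k) ` ball p (2 * r\<^sub>0)"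
    proof (rule ccontr)
      assume "\<not> ?thesis"
      then obtain c\<^sub>1 c\<^sub>2 where "norm c\<^sub>1 = a" "c\<^sub>1 \<notin> (f ^^ k) ` ball p (2 * r\<^sub>0)"
          "norm c\<^sub>2 = 2 * a" "c\<^sub>2 \<notin> (f ^^ k) ` ball p (2 * r\<^sub>0)"
        by (auto simp only: subset_iff mem_sphere_0)
      then have "norm ((f ^^ k) w) \<le> D * a"
        using D(2)[OF holomorphic_funpow[OF hol] apos(1,3) _ _ _ _ w] by blast
      then show False using \<open>D * a < norm ((f ^^ k) w)\<close> by simp
    qed
    then obtain a' where a': "a \<le> a'" "sphere 0 a' \<subseteq> (f ^^ k) ` ball p (2 * r\<^sub>0)"
      using apos by (force intro: that[of a] that[of "2 * a"])
    obtain \<zeta> where \<zeta>: "norm \<zeta> = a'" "\<bar>C\<bar> * (2 * D) ^ L * a' ^ L < norm (f \<zeta>)"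
      using a\<^sub>0(2)[of a'] a'(1) apos by auto
    then obtain y where y: "y \<in> ball p (2 * r\<^sub>0)" "\<zeta> = (f ^^ k) y"
      using a'(2) by auto
    have "C * s ^ L \<le> \<bar>C\<bar> * s ^ L" by (intro mult_right_mono) (auto simp: s_def)
    also have "\<dots> = \<bar>C\<bar> * (2 * D) ^ L * a ^ L" by (simp add: sa power_mult_distrib mult.assoc)
    also have "\<dots> \<le> \<bar>C\<bar> * (2 * D) ^ L * a' ^ L"
      using apos a'(1) D(1) by (intro mult_left_mono power_mono) auto
    also have "\<dots> < norm (f \<zeta>)" by (rule \<zeta>)
    also have "f \<zeta> = (f ^^ k) (f y)" by (simp add: y(2) funpow_swap1)
    finally have "C * s ^ L < norm ((f ^^ k) (f y))" .
    moreover have "f y \<in> X" using M y(1) by force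
    ultimately show ?thesis unfolding s_def by blast
  qed
  then show ?thesis using that by blast
qed

text \<open>An entire function that is not a translation has a point fixed by its second iterate,
  and the orbit of such a point has at most two elements.\<close>

lemma transcendental_bounded_orbit:
  assumes "transcendental_entire f"
  obtains p b where "\<And>k. norm ((f ^^ k) p) \<le> b"
proof -
  have "f \<noteq> (\<lambda>x. a + x)" for a
  proof
    assume "f = (\<lambda>x. a + x)"
    then have "\<forall>z. f z = poly [:a, 1:] z" by simp
    then show False using assms unfolding transcendental_entire_def by blast
  qed
  then obtain p where p: "f (f p) = p"
    using holomorphic_involution_point assms unfolding transcendental_entire_def by blast
  have "(f ^^ k) p = p \<or> (f ^^ k) p = f p" for k
    by (induction k) (use p in auto)
  then have "norm ((f ^^ k) p) \<le> max (norm p) (norm (f p))" for k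
    by (metis max.cobounded1 max.cobounded2)
  then show ?thesis using that by blast
qed

section \<open>Contradiction from an unbounded Fatou component\<close>

theorem theorem7:
  fixes f :: "complex \<Rightarrow> complex" and c :: complex and r :: real
    and \<gamma> :: "nat \<Rightarrow> complex set"
  assumes "transcendental_entire f"
    and "r > 0" and "ball c r \<inter> Julia_set f \<noteq> {}"
    and "\<And>n. n \<ge> 1 \<Longrightarrow> Jordan_curve (\<gamma> n)"
    and "\<And>n. n \<ge> 1 \<Longrightarrow> surrounds (\<gamma> n) ((f ^^ n) ` ball c r)"
    and "\<And>n. n \<ge> 1 \<Longrightarrow> surrounds (f ` \<gamma> n) (inside (\<gamma> (Suc n)))"
  shows "\<forall>C \<in> components (Fatou_set f). bounded C"
proof (rule ccontr)
  assume "\<not> ?thesis"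
  then obtain U where U: "U \<in> components (Fatou_set f)" "\<not> bounded U" by blast
  have hol: "f holomorphic_on UNIV"
    using assms(1) by (simp add: transcendental_entire_def)
  have nconst: "\<not> f constant_on UNIV"
  proof
    assume "f constant_on UNIV"
    then obtain a where "\<forall>z. f z = poly [:a:] z" by (auto simp: constant_on_def)
    then show False using assms(1) unfolding transcendental_entire_def by blast
  qed
  have cont: "continuous_on A (f ^^ n)" for A n
    by (intro holomorphic_on_imp_continuous_on holomorphic_funpow hol)
  have "open (Fatou_set f)"
    unfolding Fatou_set_def by (subst open_subopen) blast
  then have "path_connected U"
    using U(1) open_components in_components_connected connected_open_path_connected by blast
  have UF: "U \<subseteq> Fatou_set f" using U(1) in_components_subset by blast
  obtain w where w: "w \<in> U" using U(2) by (metis bounded_empty ex_in_conv)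
  obtain p b where pbd: "\<And>k. norm ((f ^^ k) p) \<le> b"
    using transcendental_bounded_orbit[OF assms(1)] by blast
  define r\<^sub>0 where "r\<^sub>0 = dist p w + 1"
  have r\<^sub>0: "0 < r\<^sub>0" "w \<in> cball p r\<^sub>0" by (auto simp: r\<^sub>0_def add_nonneg_pos)
  have "bounded (f ` cball p (2 * r\<^sub>0))"
    using cont[of _ 1] by (intro compact_imp_bounded compact_continuous_image) auto
  then obtain M where M: "f ` cball p (2 * r\<^sub>0) \<subseteq> cball p M"
    unfolding bounded_any_center[of _ p] by (auto simp: subset_iff)
  \<comment> \<open>Large enough for the disc about \<open>p\<close> to contain the given disc, the
    point \<open>w\<close>, and all values of \<open>f\<close> on
    \<open>cball p (2 * r\<^sub>0)\<close>.\<close>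
  define R where "R = \<bar>M\<bar> + r\<^sub>0 + dist p c + r"
  have R: "0 < R" "M \<le> R" "r\<^sub>0 \<le> R" "ball c r \<subseteq> ball p R"
  proof -
    show "ball c r \<subseteq> ball p R"
    proof
      fix x assume "x \<in> ball c r"
      then show "x \<in> ball p R"
        using dist_triangle[of p x c] r\<^sub>0(1) by (simp add: R_def)
    qed
  qed (use abs_ge_self[of M] abs_ge_zero[of M] zero_le_dist[of p c] r\<^sub>0(1) assms(2)
      in \<open>unfold R_def, linarith+\<close>)
  \<comment> \<open>The bound on \<open>R'\<close> places \<open>ball p (2 * R)\<close> in the disc
    bounded by the covered circle.\<close>
  obtain m R' where m: "1 \<le> m" "norm p + 2 * R \<le> R'" "sphere 0 R' \<subseteq> (f ^^ m) ` ball c r"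
    using iterate_covers_sphere[OF hol assms(2,3), of "norm p + 2 * R"] R(1)
    by (metis add_nonneg_pos mult_pos_pos norm_ge_zero zero_less_numeral)
  \<comment> \<open>The index shift by \<open>m\<close> matches curves to iterates:
    \<open>f ^^ k\<close> maps the covered circle into the image of the given disc under
    \<open>f ^^ (k + m)\<close>.\<close>
  define G where "G k = inside (\<gamma> (k + m))" for k
  have J: "Jordan_curve (\<gamma> (k + m))" for k using assms(4) m(1) by simp
  have ballG: "(f ^^ k) x \<in> G k" if "x \<in> ball p (2 * R)" for k x
  proof -
    have "(f ^^ k) ` sphere 0 R' \<subseteq> (f ^^ k) ` (f ^^ m) ` ball c r" using m(3) by blast
    also have "\<dots> = (f ^^ (k + m)) ` ball c r" by (simp add: image_comp funpow_add)
    also have "\<dots> \<subseteq> G k"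
      unfolding G_def using surrounds_Jordan_curve[OF J assms(5)] m(1) by simp
    finally have "(f ^^ k) ` ball 0 R' \<subseteq> G k"
      unfolding G_def
      by (intro image_ball_subset_inside J holomorphic_funpow hol open_map_funpow nconst) auto
    moreover have "x \<in> ball 0 R'"
      using that m(2) norm_triangle_sub[of x p] by (simp add: dist_norm norm_minus_commute)
    ultimately show ?thesis by blast
  qed
  obtain v where v: "v \<in> U" "v \<notin> G 0"
    using U(2) Jordan_curve_inside(2)[OF J[of 0]] bounded_subset unfolding G_def by blast
  obtain g where g: "path g" "path_image g \<subseteq> U" "pathstart g = w" "pathfinish g = v"
    using \<open>path_connected U\<close> w v(1) unfolding path_connected_def by blast
  define K where "K = path_image g"
  have K: "compact K" "connected K" "K \<subseteq> Fatou_set f" "w \<in> K" "v \<in> K"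
    using g UF by (auto simp: K_def)
  have esc: "\<not> (f ^^ k) ` K \<subseteq> G k" for k
    unfolding G_def
  proof (rule path_escapes_inside[OF hol K(2,4) J])
    show "surrounds (f ` \<gamma> (k + m)) (inside (\<gamma> (Suc k + m)))" for k
      using assms(6)[of "k + m"] m(1) by simp
    show "(f ^^ k) w \<in> inside (\<gamma> (k + m))" for k
      using ballG[of w k] r\<^sub>0(2) R unfolding G_def by auto
    show "\<not> K \<subseteq> inside (\<gamma> (0 + m))" using v(2) K(5) unfolding G_def by auto
  qed
  obtain C where C: "1 \<le> C"
    "\<And>h a z c\<^sub>1 c\<^sub>2. \<lbrakk>h holomorphic_on ball p (2 * R); 0 < a; norm (h p) \<le> a;
       norm c\<^sub>1 = a; norm c\<^sub>2 = 2 * a; c\<^sub>1 \<notin> h ` ball p (2 * R); c\<^sub>2 \<notin> h ` ball p (2 * R);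
       z \<in> cball p R\<rbrakk> \<Longrightarrow> norm (h z) \<le> C * a"
    using Schottky_sphere[of R "2 * R" p] R(1) by (metis mult_2 less_add_same_cancel1)
  have upper: "norm ((f ^^ k) x) \<le> C * a"
    if "x \<in> cball p R" "0 < a" "b \<le> a" "\<And>z. z \<in> K \<Longrightarrow> norm ((f ^^ k) z) \<le> a" for k x a
  proof -
    obtain z where z: "z \<in> K" "(f ^^ k) z \<in> - G k" using esc[of k] by blast
    have "norm ((f ^^ k) z) \<le> a" using that(4)[OF z(1)] .
    then have "\<exists>y. y \<in> - G k \<and> norm y = a'" if "a \<le> a'" for a'
      using connected_unbounded_attains_norm[OF Jordan_curve_inside(4,5)[OF J, of k], of "(f ^^ k) z" a']
        z \<open>a \<le> a'\<close> order_trans unfolding G_def by metis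
    then obtain c\<^sub>1 c\<^sub>2 where "c\<^sub>1 \<in> - G k" "norm c\<^sub>1 = a" "c\<^sub>2 \<in> - G k" "norm c\<^sub>2 = 2 * a"
      using \<open>0 < a\<close> by (metis mult_2 less_add_same_cancel1 less_eq_real_def)
    then show ?thesis
      using ballG pbd[of k] that by (intro C(2)[where c\<^sub>1 = c\<^sub>1 and c\<^sub>2 = c\<^sub>2] holomorphic_funpow hol) auto
  qed
  have "\<exists>n\<ge>1. \<exists>z\<in>K. norm ((f ^^ n) z) > B" for B
  proof (rule ccontr)
    assume "\<not> ?thesis"
    \<comment> \<open>The enlarged bound is positive and at least \<open>b\<close>, as
      \<open>upper\<close> requires.\<close>
    then have "\<And>n z. \<lbrakk>1 \<le> n; z \<in> K\<rbrakk> \<Longrightarrow> norm ((f ^^ n) z) \<le> \<bar>B\<bar> + \<bar>b\<bar> + 1" by force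
    then have "norm ((f ^^ n) x) \<le> C * (\<bar>B\<bar> + \<bar>b\<bar> + 1)" if "1 \<le> n" "x \<in> ball p R" for n x
      using that by (intro upper) auto
    then have "ball p R \<subseteq> Fatou_set f"
      by (rule bounded_iterates_subset_Fatou_set[OF hol R(1)])
    then show False using R(4) assms(3) unfolding Julia_set_def by blast
  qed
  then have "\<forall>j. \<exists>n\<ge>1. \<exists>z\<in>K. norm ((f ^^ n) z) > real j" by blast
  from choice[OF this] obtain n where n: "\<And>j. 1 \<le> n j" "\<And>j. \<exists>z\<in>K. norm ((f ^^ n j) z) > real j"
    by blast
  obtain s \<delta> where s: "strict_mono s" "0 < \<delta>"
      "\<And>B. \<forall>\<^sub>F j in sequentially. \<forall>z\<in>K. \<forall>w\<in>ball z \<delta>. norm ((f ^^ n (s j)) w) > B"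
  proof (rule Fatou_dichotomy_compact[where n = n, OF hol K(1,2,3) n(1)])
    fix s :: "nat \<Rightarrow> nat" and B
    assume s: "strict_mono s" "\<forall>\<^sub>F j in sequentially. \<forall>z\<in>K. norm ((f ^^ n (s j)) z) \<le> B"
    \<comment> \<open>The bounded alternative is impossible: on \<open>K\<close> the iterate with
      index \<open>n (s j)\<close> takes a value of modulus above \<open>s j\<close>, which is at
      least \<open>j\<close>.\<close>
    have "\<forall>\<^sub>F j in sequentially. B < real j"
      using filterlim_at_top_dense[THEN iffD1, OF filterlim_real_sequentially] by blast
    with s(2) have "\<forall>\<^sub>F j in sequentially. False"
    proof (rule eventually_elim2)
      fix j assume j: "\<forall>z\<in>K. norm ((f ^^ n (s j)) z) \<le> B" "B < real j"
      obtain z where "z \<in> K" "real (s j) < norm ((f ^^ n (s j)) z)" using n(2) by blast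
      moreover have "real j \<le> real (s j)" using seq_suble[OF s(1)] by simp
      ultimately show False using j by force
    qed
    then show thesis by simp
  qed (rule that)
  obtain L where L: "\<And>h x. \<lbrakk>h holomorphic_on UNIV;
        \<And>x w. \<lbrakk>x \<in> K; w \<in> ball x \<delta>\<rbrakk> \<Longrightarrow> 1 < norm (h w); x \<in> K\<rbrakk> \<Longrightarrow> norm (h x) \<le> norm (h w) ^ L"
    using Harnack_path[OF g(1) s(2)] unfolding K_def g(3) by blast
  \<comment> \<open>The exponent is \<open>Suc L\<close> so that the power of |h w| is at least |h
    w|, and hence at least \<open>b\<close>, even when \<open>L\<close> is 0.\<close>
  obtain s\<^sub>0 where s\<^sub>0: "\<And>k. s\<^sub>0 \<le> norm ((f ^^ k) w) \<Longrightarrow>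
      \<exists>x\<in>cball p M. C * norm ((f ^^ k) w) ^ (Suc L) < norm ((f ^^ k) x)"
    using iterates_outgrow_powers[OF assms(1) r\<^sub>0 M pbd] by blast
  \<comment> \<open>The three summands serve Harnack's inequality (values above 1), the requirement
    \<open>b \<le> a\<close> of \<open>upper\<close>, and the growth threshold
    \<open>s\<^sub>0\<close>.\<close>
  obtain j where j: "\<forall>z\<in>K. \<forall>w\<in>ball z \<delta>. norm ((f ^^ n (s j)) w) > 1 + \<bar>b\<bar> + \<bar>s\<^sub>0\<bar>"
    using s(3) eventually_happens trivial_limit_sequentially by blast
  define h where "h = f ^^ n (s j)"
  have h: "1 + \<bar>b\<bar> + \<bar>s\<^sub>0\<bar> < norm (h y)" if "x \<in> K" "y \<in> ball x \<delta>" for x y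
    using j that unfolding h_def by blast
  have hw: "1 + \<bar>b\<bar> + \<bar>s\<^sub>0\<bar> < norm (h w)" using h[OF K(4), of w] s(2) by simp
  then obtain x where x: "x \<in> cball p M" "C * norm (h w) ^ Suc L < norm (h x)"
    using s\<^sub>0[of "n (s j)"] unfolding h_def by force
  have pw: "norm (h w) ^ i \<le> norm (h w) ^ Suc L" if "i \<le> Suc L" for i
    using that hw by (intro power_increasing) auto
  \<comment> \<open>\<open>upper\<close> with \<open>a\<close> equal to the power of |h w| that
    bounds \<open>h\<close> on \<open>K\<close>; it applies at \<open>x\<close> because
    \<open>M \<le> R\<close>.\<close>
  have "norm (h x) \<le> C * norm (h w) ^ Suc L"
    unfolding h_def
  proof (rule upper)
    show "x \<in> cball p R" using x(1) R(2) by auto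
    show "0 < norm ((f ^^ n (s j)) w) ^ Suc L"
      by (rule zero_less_power) (use hw in \<open>unfold h_def, linarith\<close>)
    have "norm (h w) \<le> norm (h w) ^ Suc L" using pw[of 1] by (simp only: power_one_right)
    then show "b \<le> norm ((f ^^ n (s j)) w) ^ Suc L"
      using hw unfolding h_def by linarith
    fix z assume "z \<in> K"
    have "norm (h z) \<le> norm (h w) ^ L"
      using h by (intro L \<open>z \<in> K\<close>) (force simp: h_def intro!: holomorphic_funpow hol)+
    also have "\<dots> \<le> norm (h w) ^ Suc L" by (rule pw) simp
    finally show "norm ((f ^^ n (s j)) z) \<le> norm ((f ^^ n (s j)) w) ^ Suc L"
      unfolding h_def .
  qed
  then show False using x(2) by simp
qed

end
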